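(* For all integers $n\ge 0$ and $k\ge 1$, $$Ch_n^{(k)}(x)=\sum_{\ell=0}^n\sum_{m=0}^{n-\ell}\binom{n}{\ell}\,s_1(n-\ell,m)\,B_m^{(\ell)}\,E_\ell^{(k)}(x).$$
   Context: All generating functions are identities of formal power series in $t$, with $x$ an indeterminate, and $(1+t)^x=\sum_{j\ge0}\binom{x}{j}t^j$ with $\binom{x}{j}=\frac{x(x-1)\cdots(x-j+1)}{j!}$. The Changhee polynomials of the first kind with order $k$ are defined by $\sum_{n=0}^\infty Ch_n^{(k)}(x)\frac{t^n}{n!}=\left(\frac{2}{2+t}\right)^k(1+t)^x$. The Euler polynomials of order $k$ are defined by $\sum_{n=0}^\infty E_n^{(k)}(x)\frac{t^n}{n!}=\left(\frac{2}{e^t+1}\right)^k e^{xt}$. The Bernoulli numbers of order $\ell$ (for integers $\ell\ge 0$) are defined by $\sum_{n=0}^\infty B_n^{(\ell)}\frac{t^n}{n!}=\left(\frac{t}{e^t-1}\right)^{\ell}$. The (signed) Stirling numbers of the first kind $s_1(n,l)$ are defined by $\prod_{i=0}^{n-1}(x-i)=\sum_{l=0}^n s_1(n,l)x^l$, with $s_1(n,l)=0$ for $l>n$. *)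

theory Defs
  imports "HOL-Computational_Algebra.Computational_Algebra"
begin

text \<open>
  The indeterminate \<open>x\<close> is the polynomial \<open>[:0, 1:]\<close>, so the generating functions of the
  polynomial families live in the ring \<open>'a poly fps\<close> of power series in \<open>t\<close> whose coefficients
  are polynomials in \<open>x\<close>, over a field of characteristic zero. The factors not involving \<open>x\<close>
  are formed (with division) in \<open>'a fps\<close> and then embedded coefficientwise.
\<close>

definition const_fps :: "'a::zero fps \<Rightarrow> 'a poly fps" where
  "const_fps f = Abs_fps (\<lambda>n. [:fps_nth f n:])"

text \<open>The series $(1+t)^x$ and $e^{xt}$.\<close>

definition one_plus_t_powr_x :: "'a::field_char_0 poly fps" where
  "one_plus_t_powr_x = Abs_fps (\<lambda>j. smult (1 / fact j) (\<Prod>i<j. [:- of_nat i, 1:]))"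

definition exp_xt :: "'a::field_char_0 poly fps" where
  "exp_xt = Abs_fps (\<lambda>j. smult (1 / fact j) ([:0, 1:] ^ j))"

definition Changhee_poly :: "nat \<Rightarrow> nat \<Rightarrow> 'a::field_char_0 poly" where
  "Changhee_poly k n =
     smult (fact n) (fps_nth (const_fps ((2 / (2 + fps_X)) ^ k) * one_plus_t_powr_x) n)"

definition Euler_poly :: "nat \<Rightarrow> nat \<Rightarrow> 'a::field_char_0 poly" where
  "Euler_poly k n =
     smult (fact n) (fps_nth (const_fps ((2 / (fps_exp 1 + 1)) ^ k) * exp_xt) n)"

text \<open>
  Both \<open>fps_X\<close> and \<open>fps_exp 1 - 1\<close> have order one; the quotient below is the exact one
  (see \<open>Bernoulli_egf_quotient\<close>).
\<close>

definition Bernoulli_num :: "nat \<Rightarrow> nat \<Rightarrow> 'a::field_char_0" where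
  "Bernoulli_num l n = fact n * fps_nth ((fps_X / (fps_exp 1 - 1)) ^ l) n"

definition stirling1 :: "nat \<Rightarrow> nat \<Rightarrow> int" where
  "stirling1 n l = coeff (\<Prod>i<n. [:- int i, 1:]) l"

lemma Changhee_poly_egf:
  "Abs_fps (\<lambda>n. smult (1 / fact n) (Changhee_poly k n)) =
     const_fps ((2 / (2 + fps_X)) ^ k) * one_plus_t_powr_x"
  by (rule fps_ext) (simp add: Changhee_poly_def)

lemma Euler_poly_egf:
  "Abs_fps (\<lambda>n. smult (1 / fact n) (Euler_poly k n)) =
     const_fps ((2 / (fps_exp 1 + 1)) ^ k) * exp_xt"
  by (rule fps_ext) (simp add: Euler_poly_def)

lemma Bernoulli_num_egf:
  "Abs_fps (\<lambda>n. Bernoulli_num l n / fact n) = (fps_X / (fps_exp 1 - 1)) ^ l"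
  by (rule fps_ext) (simp add: Bernoulli_num_def)

lemma Bernoulli_egf_quotient:
  "fps_X / (fps_exp 1 - 1) * (fps_exp 1 - 1) = (fps_X :: 'a::field_char_0 fps)"
proof -
  have nz: "fps_nth (fps_exp 1 - 1 :: 'a fps) 1 \<noteq> 0"
    by simp
  have "subdegree (fps_exp 1 - 1 :: 'a fps) = 1"
    by (rule subdegreeI) (use nz in auto)
  moreover have "(fps_exp 1 - 1 :: 'a fps) \<noteq> 0"
    using nz by force
  ultimately have "(fps_exp 1 - 1 :: 'a fps) dvd fps_X"
    by (simp add: fps_dvd_iff)
  thus ?thesis
    by simp
qed

lemma poly_one_plus_t_powr_x_nth: "poly (fps_nth one_plus_t_powr_x j) c = c gchoose j"
  by (simp add: one_plus_t_powr_x_def gbinomial_prod_rev poly_prod atLeast0LessThan)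

end

theory Submission
  imports Defs
begin

text \<open>
  Write \<open>L = log (1 + t)\<close>, the compositional inverse of \<open>e\<^sup>t - 1\<close>. Substituting \<open>L\<close> for \<open>t\<close> in
  the generating function of the Euler polynomials turns \<open>e\<^sup>t\<close> into \<open>1 + t\<close>, and so gives the
  generating function of the Changhee polynomials. Since
  \<open>L\<^sup>l / l! = (\<Sum>n. s\<^sub>1(n,l) t\<^sup>n / n!)\<close> (lemma \<open>fps_ln_power_nth\<close>), this substitution means that
  \<open>Ch\<^sub>n = (\<Sum>l\<le>n. s\<^sub>1(n,l) E\<^sub>l)\<close> (lemma \<open>Changhee_poly_conv_Euler_poly\<close>).

  It remains to express \<open>s\<^sub>1(n,l)\<close> through the Bernoulli numbers of order \<open>l\<close>. The same
  substitution turns \<open>(t / (e\<^sup>t - 1))\<^sup>l\<close> into \<open>(L / t)\<^sup>l\<close>, which is up to the factor \<open>l!\<close> the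
  generating function of the \<open>s\<^sub>1(n,l)\<close> shifted by \<open>l\<close>. Reading off coefficients gives
  \<open>s\<^sub>1(n,l) = (n choose l) * (\<Sum>m\<le>n-l. s\<^sub>1(n-l,m) B\<^sub>m\<^sup>(\<^sup>l\<^sup>))\<close> (lemma \<open>stirling1_conv_Bernoulli_num\<close>).
\<close>

lemma coeff_mult_linear_0: "coeff (p * [:a, 1:]) 0 = a * coeff p 0"
  for a :: "'a::comm_ring_1"
  by simp

lemma coeff_mult_linear_Suc: "coeff (p * [:a, 1:]) (Suc j) = coeff p j + a * coeff p (Suc j)"
  for a :: "'a::comm_ring_1"
  by simp

lemma stirling1_0_left: "stirling1 0 l = (if l = 0 then 1 else 0)"
  by (simp add: stirling1_def)

lemma stirling1_Suc_0: "stirling1 (Suc n) 0 = - int n * stirling1 n 0"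
  unfolding stirling1_def prod.lessThan_Suc coeff_mult_linear_0 ..

lemma stirling1_Suc_Suc: "stirling1 (Suc n) (Suc l) = stirling1 n l - int n * stirling1 n (Suc l)"
  unfolding stirling1_def prod.lessThan_Suc coeff_mult_linear_Suc by simp

lemma coeff_falling_factorial:
  "coeff (\<Prod>i<n. [:- of_nat i, 1:]) l = (of_int (stirling1 n l) :: 'a::comm_ring_1)"
proof (induction n arbitrary: l)
  case 0
  then show ?case by (simp add: stirling1_0_left)
next
  case (Suc n)
  then show ?case
    unfolding prod.lessThan_Suc
    by (cases l) (simp_all only: coeff_mult_linear_0 coeff_mult_linear_Suc
        stirling1_Suc_0 stirling1_Suc_Suc, simp_all)
qed

text \<open>
  The differential equation \<open>(1 + t) (L\<^sup>m\<^sup>+\<^sup>1)' = (m + 1) L\<^sup>m\<close> yields, coefficient by coefficient,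
  the recurrence of the Stirling numbers.
\<close>

lemma fps_ln_power_nth_rec:
  "of_nat (Suc n) * fps_nth (fps_ln (1::'a::field_char_0) ^ Suc m) (Suc n) =
     of_nat (Suc m) * fps_nth (fps_ln 1 ^ m) n - of_nat n * fps_nth (fps_ln 1 ^ Suc m) n"
proof -
  let ?D = "fps_deriv (fps_ln (1::'a) ^ Suc m)"
  have "(1 + fps_X) * ?D =
      fps_const (of_nat (Suc m)) * fps_ln 1 ^ m * ((1 + fps_X) * inverse (1 + fps_X))"
    unfolding fps_deriv_power by (simp add: fps_ln_deriv del: of_nat_Suc)
  also have "(1 + fps_X) * inverse (1 + fps_X) = (1 :: 'a fps)"
    by (subst mult.commute) (simp add: inverse_mult_eq_1)
  finally have "fps_nth ((1 + fps_X) * ?D) n = of_nat (Suc m) * fps_nth (fps_ln 1 ^ m) n"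
    by simp
  moreover have "fps_nth ((1 + fps_X) * ?D) n =
      of_nat (Suc n) * fps_nth (fps_ln (1::'a) ^ Suc m) (Suc n)
      + of_nat n * fps_nth (fps_ln 1 ^ Suc m) n"
    by (cases n) (simp_all add: distrib_right del: of_nat_Suc power_Suc fps_deriv_power)
  ultimately show ?thesis by (simp add: algebra_simps)
qed

lemma fps_ln_power_nth:
  "fps_nth (fps_ln (1::'a::field_char_0) ^ m) n = fact m * of_int (stirling1 n m) / fact n"
proof (induction n arbitrary: m)
  case 0
  show ?case by (cases m) (simp_all add: stirling1_0_left fps_nth_power_0)
next
  case (Suc n)
  show ?case
  proof (cases m)
    case 0
    \<comment> \<open>The constant \<open>L\<^sup>0 = 1\<close> has no term of positive degree, hence \<open>s\<^sub>1(n,0) = 0\<close> for \<open>n > 0\<close>.\<close>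
    have "of_nat n * of_int (stirling1 n 0) = (0 :: 'a)"
      using Suc.IH[of 0] by (cases n) auto
    then show ?thesis using 0 by (simp add: stirling1_Suc_0)
  next
    case (Suc m')
    have "of_nat (Suc n) * fps_nth (fps_ln (1::'a) ^ Suc m') (Suc n) =
        fact (Suc m') * of_int (stirling1 (Suc n) (Suc m')) / fact n"
      unfolding fps_ln_power_nth_rec Suc.IH stirling1_Suc_Suc
      by (simp add: field_simps)
    moreover have "of_nat (Suc n) \<noteq> (0 :: 'a)" by (rule of_nat_neq_0)
    ultimately show ?thesis
      unfolding Suc fact_Suc[of n] by (simp add: field_simps del: of_nat_Suc power_Suc fact_Suc)
  qed
qed

lemma fps_exp_compose_ln: "fps_exp 1 oo fps_ln 1 = (1 + fps_X :: 'a::field_char_0 fps)"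
proof -
  have "(fps_exp 1 - 1) oo fps_ln (1::'a) = fps_X"
    unfolding fps_ln_fps_exp_inv[OF one_neq_zero] by (rule fps_inv_right) simp_all
  then show ?thesis by (simp add: fps_compose_sub_distrib algebra_simps)
qed

lemma Bernoulli_egf_compose_ln:
  "((fps_X / (fps_exp 1 - 1)) ^ l oo fps_ln 1) * fps_X ^ l = (fps_ln (1::'a::field_char_0) ^ l)"
proof -
  have "(fps_X / (fps_exp 1 - 1) oo fps_ln 1) * ((fps_exp 1 - 1) oo fps_ln 1) =
      fps_ln (1::'a)"
    unfolding fps_compose_mult_distrib[OF fps_ln_0, symmetric] Bernoulli_egf_quotient by simp
  then have "(fps_X / (fps_exp 1 - 1) oo fps_ln 1) * fps_X = fps_ln (1::'a)"
    by (simp add: fps_compose_sub_distrib fps_exp_compose_ln)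
  then show ?thesis
    by (metis fps_compose_power[OF fps_ln_0] power_mult_distrib)
qed

lemma stirling1_conv_Bernoulli_num:
  assumes "l \<le> n"
  shows "of_int (stirling1 n l) =
    of_nat (n choose l) *
      (\<Sum>m\<le>n - l. of_int (stirling1 (n - l) m) * (Bernoulli_num l m :: 'a::field_char_0))"
proof -
  let ?S = "\<Sum>m\<le>n - l. of_int (stirling1 (n - l) m) * (Bernoulli_num l m :: 'a)"
  have "fact l * of_int (stirling1 n l) / fact n = fps_nth (fps_ln (1::'a) ^ l) n"
    by (rule fps_ln_power_nth[symmetric])
  also have "\<dots> = fps_nth ((fps_X / (fps_exp 1 - 1)) ^ l oo fps_ln 1) (n - l)"
    unfolding Bernoulli_egf_compose_ln[symmetric] fps_X_power_mult_right_nth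
    using assms by simp
  also have "\<dots> = ?S / fact (n - l)"
    unfolding fps_compose_nth fps_ln_power_nth Bernoulli_num_def sum_divide_distrib atMost_atLeast0
    by (rule sum.cong) (simp_all add: field_simps)
  finally show ?thesis
    using assms by (simp add: binomial_fact field_simps)
qed

text \<open>
  The law for composing a quotient such as \<open>2 / (e\<^sup>t + 1)\<close> with \<open>L\<close> needs coefficients in a
  field. A series with polynomial coefficients is therefore cut into its coefficients of \<open>x\<^sup>j\<close>,
  and the slices of \<open>e\<^sup>x\<^sup>t\<close> and \<open>(1 + t)\<^sup>x\<close> are \<open>t\<^sup>j / j!\<close> and \<open>L\<^sup>j / j!\<close>.
\<close>

definition x_slice :: "nat \<Rightarrow> 'a::zero poly fps \<Rightarrow> 'a fps" where
  "x_slice j A = Abs_fps (\<lambda>n. coeff (fps_nth A n) j)"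

lemma x_slice_const_mult:
  "x_slice j (const_fps F * A) = F * x_slice j A" for F :: "'a::comm_ring_1 fps"
  by (rule fps_ext) (simp add: x_slice_def const_fps_def fps_mult_nth coeff_sum)

lemma coeff_x_power: "coeff ([:0, 1:] ^ n) j = (if j = n then 1 else 0 :: 'a::comm_ring_1)"
  using coeff_monom[of "1 :: 'a" n j] by (auto simp: monom_altdef)

lemma x_slice_exp_xt:
  "x_slice j exp_xt = fps_const (1 / fact j) * (fps_X ^ j :: 'a::field_char_0 fps)"
  by (rule fps_ext) (simp add: x_slice_def exp_xt_def coeff_x_power)

lemma x_slice_one_plus_t_powr_x:
  "x_slice j one_plus_t_powr_x = fps_const (1 / fact j) * fps_ln (1::'a::field_char_0) ^ j"
  by (rule fps_ext)
    (simp add: x_slice_def one_plus_t_powr_x_def coeff_falling_factorial fps_ln_power_nth)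

lemma x_slice_Changhee_egf:
  "x_slice j (const_fps ((2 / (2 + fps_X)) ^ k) * one_plus_t_powr_x) =
     x_slice j (const_fps ((2 / (fps_exp 1 + 1)) ^ k) * exp_xt) oo fps_ln (1::'a::field_char_0)"
proof -
  have "2 / (fps_exp 1 + 1) oo fps_ln (1::'a) = 2 / (2 + fps_X)"
    by (subst fps_divide_compose)
      (simp_all add: fps_compose_add_distrib fps_exp_compose_ln add.commute add.left_commute)
  then show ?thesis
    by (simp add: x_slice_const_mult x_slice_exp_xt x_slice_one_plus_t_powr_x
        fps_compose_mult_distrib fps_compose_power[symmetric])
qed

lemma Changhee_poly_conv_Euler_poly:
  "Changhee_poly k n =
     (\<Sum>l\<le>n. smult (of_int (stirling1 n l)) (Euler_poly k l :: 'a::field_char_0 poly))"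
proof (rule poly_eqI)
  fix j
  let ?E = "const_fps ((2 / (fps_exp 1 + 1)) ^ k) * exp_xt :: 'a poly fps"
  let ?C = "const_fps ((2 / (2 + fps_X)) ^ k) * one_plus_t_powr_x :: 'a poly fps"
  have "coeff (Changhee_poly k n :: 'a poly) j = fact n * fps_nth (x_slice j ?C) n"
    by (simp add: Changhee_poly_def x_slice_def)
  also have "\<dots> = (\<Sum>l\<le>n. of_int (stirling1 n l) * (fact l * fps_nth (x_slice j ?E) l))"
    unfolding x_slice_Changhee_egf fps_compose_nth fps_ln_power_nth sum_distrib_left atMost_atLeast0
    by (rule sum.cong) simp_all
  also have "\<dots> = coeff (\<Sum>l\<le>n. smult (of_int (stirling1 n l)) (Euler_poly k l :: 'a poly)) j"
    by (simp add: Euler_poly_def x_slice_def coeff_sum mult.assoc)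
  finally show "coeff (Changhee_poly k n :: 'a poly) j = \<dots>" .
qed

theorem mainTheorem6:
  fixes n k :: nat
  assumes "k \<ge> 1"
  shows "(Changhee_poly k n :: 'a::field_char_0 poly) =
    (\<Sum>l\<le>n. \<Sum>m\<le>n - l.
       smult (of_nat (n choose l) * of_int (stirling1 (n - l) m) * Bernoulli_num l m)
         (Euler_poly k l))"
  unfolding Changhee_poly_conv_Euler_poly
proof (rule sum.cong[OF refl])
  fix l assume "l \<in> {..n}"
  then show "smult (of_int (stirling1 n l)) (Euler_poly k l :: 'a poly) =
      (\<Sum>m\<le>n - l.
         smult (of_nat (n choose l) * of_int (stirling1 (n - l) m) * Bernoulli_num l m)
           (Euler_poly k l))"
    by (subst stirling1_conv_Bernoulli_num)
      (simp_all add: sum_distrib_left mult.assoc flip: smult_sum)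
qed

end
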